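(* For every $\lambda>0$, the standard-form Tikhonov problem $$\min_{x\in\mathbb{R}^n}\{\|Ax-b\|^2+\lambda^2\|x\|^2\}$$ is equivalent to the standard-form Tikhonov problem with the same $\lambda$ $$\min_{x\in\mathbb{R}^n}\{\|A^{\prime}x-b\|^2+\lambda^2\|x\|^2\},$$ i.e., the two problems have the same solution $x_\lambda$.
   Context: $\|\cdot\|$ is the 2-norm. Let $m\ge n$ and let $A\in\mathbb{R}^{m\times n}$ have the SVD $$A=\widehat U\begin{pmatrix}\Sigma\\ \mathbf 0\end{pmatrix}\widehat V^T,\qquad \Sigma=\mathrm{diag}(\sigma_1I_{c_1},\ldots,\sigma_sI_{c_s}),$$ with $\sigma_1>\sigma_2>\cdots>\sigma_s>0$ the distinct singular values, $\sigma_i$ of multiplicity $c_i$, $c_1+\cdots+c_s=n$, and $\widehat U=(\widehat U_1,\ldots,\widehat U_s,\widehat U_\perp)\in\mathbb{R}^{m\times m}$, $\widehat V=(\widehat V_1,\ldots,\widehat V_s)\in\mathbb{R}^{n\times n}$ orthogonal, $\widehat U_i\in\mathbb{R}^{m\times c_i}$, $\widehat V_i\in\mathbb{R}^{n\times c_i}$. Let $b\in\mathbb{R}^m$ with $\widehat U_i^Tb\neq 0$ for $i=1,\ldots,s$. Define $$u_i=\frac{\widehat U_i\widehat U_i^Tb}{\|\widehat U_i^Tb\|},\qquad v_i=\frac{A^Tu_i}{\sigma_i},\qquad i=1,\ldots,s.$$ For each $i$ complete $u_i$ to an orthonormal basis of the column space of $\widehat U_i$, and map the additional $c_i-1$ vectors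 $u$ to $A^Tu/\sigma_i$, so that together with $v_i$ these form an orthonormal basis of the column space of $\widehat V_i$. Let $U_\perp\in\mathbb{R}^{m\times(n-s)}$ and $V_\perp\in\mathbb{R}^{n\times(n-s)}$ collect all the additional left and right vectors, let $U=(u_1,\ldots,u_s,U_\perp)$, $V=(v_1,\ldots,v_s,V_\perp)$, and define $$A^{\prime}=U\,\mathrm{diag}(\sigma_1,\ldots,\sigma_s,0,\ldots,0)\,V^T\in\mathbb{R}^{m\times n}.$$ *)

theory Defs
  imports Complex_Main "Jordan_Normal_Form.VS_Connect"
begin

definition vec_norm2 :: "real vec \<Rightarrow> real" where
  "vec_norm2 x = sqrt (x \<bullet> x)"

(* The library's orthogonal_mat only asks for the transpose times the matrix to be an
   invertible diagonal matrix; an orthogonal matrix in the usual sense has orthonormal columns. *)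
definition real_orthogonal_mat :: "nat \<Rightarrow> real mat \<Rightarrow> bool" where
  "real_orthogonal_mat k M \<longleftrightarrow>
     M \<in> carrier_mat k k \<and> M\<^sup>T * M = 1\<^sub>m k \<and> M * M\<^sup>T = 1\<^sub>m k"

(* The block matrix (M_1, M_2, ...), all blocks having r rows. *)
definition hcat :: "nat \<Rightarrow> real mat list \<Rightarrow> real mat" where
  "hcat r Ms = mat_of_cols r (concat (map cols Ms))"

(* Blocks are numbered 0, ..., s - 1. Only the values of sigma, c, Uh and Vh below s matter. *)
definition block_svd ::
  "nat \<Rightarrow> nat \<Rightarrow> real mat \<Rightarrow> nat \<Rightarrow> (nat \<Rightarrow> real) \<Rightarrow> (nat \<Rightarrow> nat) \<Rightarrow>
   (nat \<Rightarrow> real mat) \<Rightarrow> real mat \<Rightarrow> (nat \<Rightarrow> real mat) \<Rightarrow> bool" where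
  "block_svd m n A s \<sigma> c Uh Uhperp Vh \<longleftrightarrow>
     A \<in> carrier_mat m n \<and>
     (\<forall>i<s. \<forall>j<s. i < j \<longrightarrow> \<sigma> j < \<sigma> i) \<and> (\<forall>i<s. 0 < \<sigma> i) \<and>
     (\<forall>i<s. 1 \<le> c i) \<and> (\<Sum>i<s. c i) = n \<and>
     (\<forall>i<s. Uh i \<in> carrier_mat m (c i)) \<and> Uhperp \<in> carrier_mat m (m - n) \<and>
     (\<forall>i<s. Vh i \<in> carrier_mat n (c i)) \<and>
     real_orthogonal_mat m (hcat m (map Uh [0..<s] @ [Uhperp])) \<and>
     real_orthogonal_mat n (hcat n (map Vh [0..<s])) \<and>
     A = hcat m (map Uh [0..<s] @ [Uhperp])
           * (diag_block_mat (map (\<lambda>i. \<sigma> i \<cdot>\<^sub>m 1\<^sub>m (c i)) [0..<s]) @\<^sub>r 0\<^sub>m (m - n) n)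
           * (hcat n (map Vh [0..<s]))\<^sup>T"

definition left_vec :: "real mat \<Rightarrow> real vec \<Rightarrow> real vec" where
  "left_vec Ui b = (1 / vec_norm2 (Ui\<^sup>T *\<^sub>v b)) \<cdot>\<^sub>v (Ui *\<^sub>v (Ui\<^sup>T *\<^sub>v b))"

definition right_vec :: "real mat \<Rightarrow> real \<Rightarrow> real vec \<Rightarrow> real vec" where
  "right_vec A \<sigma>i u = (1 / \<sigma>i) \<cdot>\<^sub>v (A\<^sup>T *\<^sub>v u)"

definition orthonormal_basis_list :: "nat \<Rightarrow> real vec list \<Rightarrow> real vec set \<Rightarrow> bool" where
  "orthonormal_basis_list k vs S \<longleftrightarrow>
     set vs \<subseteq> carrier_vec k \<and>
     (\<forall>i<length vs. \<forall>j<length vs. vs ! i \<bullet> vs ! j = (if i = j then 1 else 0)) \<and>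
     LinearCombinations.module.span class_ring (module_vec TYPE(real) k) (set vs) = S"

(* W i lists the additional left vectors, those completing u_i to an orthonormal basis
   of the column space of the block Uh i. *)

definition Umat ::
  "nat \<Rightarrow> nat \<Rightarrow> (nat \<Rightarrow> real mat) \<Rightarrow> real vec \<Rightarrow> (nat \<Rightarrow> real vec list) \<Rightarrow> real mat" where
  "Umat m s Uh b W =
     hcat m [mat_of_cols m (map (\<lambda>i. left_vec (Uh i) b) [0..<s]),
             mat_of_cols m (concat (map W [0..<s]))]"

definition Vmat ::
  "nat \<Rightarrow> real mat \<Rightarrow> nat \<Rightarrow> (nat \<Rightarrow> real) \<Rightarrow> (nat \<Rightarrow> real mat) \<Rightarrow> real vec \<Rightarrow>
   (nat \<Rightarrow> real vec list) \<Rightarrow> real mat" where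
  "Vmat n A s \<sigma> Uh b W =
     hcat n [mat_of_cols n (map (\<lambda>i. right_vec A (\<sigma> i) (left_vec (Uh i) b)) [0..<s]),
             mat_of_cols n (concat (map (\<lambda>i. map (right_vec A (\<sigma> i)) (W i)) [0..<s]))]"

definition A_prime ::
  "nat \<Rightarrow> nat \<Rightarrow> real mat \<Rightarrow> nat \<Rightarrow> (nat \<Rightarrow> real) \<Rightarrow> (nat \<Rightarrow> real mat) \<Rightarrow> real vec \<Rightarrow>
   (nat \<Rightarrow> real vec list) \<Rightarrow> real mat" where
  "A_prime m n A s \<sigma> Uh b W =
     Umat m s Uh b W * mat_diag n (\<lambda>i. if i < s then \<sigma> i else 0)
       * (Vmat n A s \<sigma> Uh b W)\<^sup>T"

definition tikhonov_objective :: "real mat \<Rightarrow> real vec \<Rightarrow> real \<Rightarrow> real vec \<Rightarrow> real" where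
  "tikhonov_objective M b l x = (vec_norm2 (M *\<^sub>v x - b))\<^sup>2 + l\<^sup>2 * (vec_norm2 x)\<^sup>2"

definition tikhonov_solutions :: "nat \<Rightarrow> real mat \<Rightarrow> real vec \<Rightarrow> real \<Rightarrow> real vec set" where
  "tikhonov_solutions n M b l =
     {x \<in> carrier_vec n. \<forall>y \<in> carrier_vec n.
        tikhonov_objective M b l x \<le> tikhonov_objective M b l y}"

end

(* The solution of a Tikhonov problem is the unique x with M^T (b - M x) = lam^2 x.
   Let P and Q have the columns u_i and v_i, i < s, and let S = diag(sigma_i).
   Then M Q = P S, M^T P = Q S and M^T b = M^T P P^T b hold for both M = A and M = A', and these
   three relations alone make x = Q (S^2 + lam^2 I)^(-1) S P^T b satisfy the normal equations:
   b acts on each singular subspace only through the single direction u_i. *)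

theory Submission
  imports Defs
begin

text \<open>The third relation has a different origin for each matrix. For A, the definition of u_i
  gives Uh_i Uh_i^T b = |Uh_i^T b| u_i, so P P^T b is the orthogonal projection of b onto the sum of
  the column spaces of the blocks. The residual b - P P^T b is orthogonal to every Uh_i, and A^T
  annihilates it because A maps Vh_i to multiples of Uh_i. For A' = P S Q^T all three relations are
  formal consequences of P^T P = I and Q^T Q = I, and orthonormality of the v_i is inherited from
  the u_i through A. The obstacle is indexing: the SVD is stated with concatenated matrices, while
  the argument works block by block. The translation is done once, and yields four blockwise facts.
  No calculus is used: at a solution of the normal equations the objective splits into a sum of
  squares, and lam > 0 makes the minimizer unique.\<close>

section \<open>Normal equations characterize the Tikhonov solution\<close>

lemma vec_norm2_sq:
  assumes "x \<in> carrier_vec k"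
  shows "(vec_norm2 x)\<^sup>2 = x \<bullet> x" "0 \<le> x \<bullet> x"
proof -
  show "0 \<le> x \<bullet> x" by (auto simp: scalar_prod_def intro: sum_nonneg)
  then show "(vec_norm2 x)\<^sup>2 = x \<bullet> x" by (simp add: vec_norm2_def)
qed

lemma vec_norm2_pos:
  assumes "x \<in> carrier_vec k" "x \<noteq> 0\<^sub>v k"
  shows "0 < vec_norm2 x"
proof -
  \<comment> \<open>Conjugation is the identity on the reals, so definiteness of the Hermitian
    product applies.\<close>
  have "x \<bullet> x \<noteq> 0"
    using conjugate_square_eq_0_vec[OF assms(1)] assms(2) by simp
  then show ?thesis
    using vec_norm2_sq(2)[OF assms(1)] by (simp add: vec_norm2_def)
qed

lemma scalar_prod_add_square:
  fixes x y :: "real vec"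
  assumes "x \<in> carrier_vec k" "y \<in> carrier_vec k"
  shows "(x + y) \<bullet> (x + y) = x \<bullet> x + 2 * (x \<bullet> y) + y \<bullet> y"
  using assms
  by (simp add: add_scalar_prod_distrib[of _ k] scalar_prod_add_distrib[of _ k]
      comm_scalar_prod[of y k x])

text \<open>The two squares contribute the cross terms 2 (Mx - b) . Md and 2 l^2 (x . d). Moving
  \<open>M\<close> across the first product turns it into -2 (M^T (b - Mx)) . d, and the normal
  equations make the two cancel.\<close>

lemma tikhonov_objective_split:
  assumes M: "M \<in> carrier_mat m n" and b: "b \<in> carrier_vec m"
    and x: "x \<in> carrier_vec n" and d: "d \<in> carrier_vec n"
    and normal: "M\<^sup>T *\<^sub>v (b - M *\<^sub>v x) = l\<^sup>2 \<cdot>\<^sub>v x"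
  shows "tikhonov_objective M b l (x + d)
    = tikhonov_objective M b l x + (vec_norm2 (M *\<^sub>v d))\<^sup>2 + l\<^sup>2 * (vec_norm2 d)\<^sup>2"
proof -
  let ?r = "M *\<^sub>v x - b"
  have Mx: "M *\<^sub>v x \<in> carrier_vec m" and Md: "M *\<^sub>v d \<in> carrier_vec m"
    using M x d by auto
  have r: "?r \<in> carrier_vec m" using Mx b by auto
  have eq: "M *\<^sub>v (x + d) - b = ?r + M *\<^sub>v d"
    unfolding mult_add_distrib_mat_vec[OF M x d]
    using Mx Md b by (intro eq_vecI) (auto simp del: index_mult_mat_vec dim_mult_mat_vec)
  have neg: "?r = (-1) \<cdot>\<^sub>v (b - M *\<^sub>v x)"
    using Mx b by (intro eq_vecI) (auto simp del: index_mult_mat_vec dim_mult_mat_vec)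
  have "?r \<bullet> (M *\<^sub>v d) = - ((b - M *\<^sub>v x) \<bullet> (M *\<^sub>v d))"
    unfolding neg using Mx Md b by (subst smult_scalar_prod_distrib[of _ m]) auto
  also have "(b - M *\<^sub>v x) \<bullet> (M *\<^sub>v d) = (M\<^sup>T *\<^sub>v (b - M *\<^sub>v x)) \<bullet> d"
    using transpose_vec_mult_scalar[OF M d, of "b - M *\<^sub>v x"] Mx b by auto
  also have "\<dots> = l\<^sup>2 * (x \<bullet> d)"
    unfolding normal using x d by simp
  finally have cross: "?r \<bullet> (M *\<^sub>v d) = - (l\<^sup>2 * (x \<bullet> d))" .
  have xd: "x + d \<in> carrier_vec n" and rd: "?r + M *\<^sub>v d \<in> carrier_vec m"
    using x d r Md by auto
  show ?thesis
    unfolding tikhonov_objective_def eq vec_norm2_sq(1)[OF rd] vec_norm2_sq(1)[OF xd]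
      vec_norm2_sq(1)[OF r] vec_norm2_sq(1)[OF x] vec_norm2_sq(1)[OF d] vec_norm2_sq(1)[OF Md]
      scalar_prod_add_square[OF r Md] scalar_prod_add_square[OF x d] cross
    by (simp add: algebra_simps)
qed

text \<open>Write any competitor as x + d with d = y - x. The split shows that its excess over the
  value at \<open>x\<close> is at least l^2 |d|^2, which gives minimality, and uniqueness since
  \<open>l\<close> is positive.\<close>

lemma tikhonov_solutions_normal_eq:
  assumes M: "M \<in> carrier_mat m n" and b: "b \<in> carrier_vec m" and l: "0 < l"
    and x: "x \<in> carrier_vec n"
    and normal: "M\<^sup>T *\<^sub>v (b - M *\<^sub>v x) = l\<^sup>2 \<cdot>\<^sub>v x"
  shows "tikhonov_solutions n M b l = {x}"
proof -
  note split = tikhonov_objective_split[OF M b x _ normal]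
  have min: "tikhonov_objective M b l x \<le> tikhonov_objective M b l y"
    if y: "y \<in> carrier_vec n" for y
  proof -
    have "x + (y - x) = y" using x y by (intro eq_vecI) auto
    then show ?thesis using split[of "y - x"] x y by simp
  qed
  have uniq: "y = x"
    if y: "y \<in> carrier_vec n" and le: "tikhonov_objective M b l y \<le> tikhonov_objective M b l x" for y
  proof (rule ccontr)
    assume ne: "y \<noteq> x"
    have d: "y - x \<in> carrier_vec n" using x y by auto
    have "x + (y - x) = y" using x y by (intro eq_vecI) auto
    moreover have "y - x \<noteq> 0\<^sub>v n"
    proof
      assume "y - x = 0\<^sub>v n"
      with \<open>x + (y - x) = y\<close> x ne show False by simp
    qed
    then have "0 < l\<^sup>2 * (vec_norm2 (y - x))\<^sup>2"
      using vec_norm2_pos[OF d] l by simp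
    ultimately show False using split[OF d] le zero_le_power2[of "vec_norm2 (M *\<^sub>v (y - x))"] by simp
  qed
  show ?thesis unfolding tikhonov_solutions_def using x min uniq by blast
qed

section \<open>The solution in terms of singular triples\<close>

lemma mat_diag_mult_vec:
  assumes "y \<in> carrier_vec k"
  shows "mat_diag k f *\<^sub>v y = vec k (\<lambda>i. f i * y $ i :: real)"
proof (rule eq_vecI)
  fix i assume "i < dim_vec (vec k (\<lambda>i. f i * y $ i))"
  then have i: "i < k" by simp
  have "(mat_diag k f *\<^sub>v y) $ i = (\<Sum>j<k. (if i = j then f j else 0) * y $ j)"
    using assms i by (simp add: mat_diag_def mult_mat_vec_def scalar_prod_def atLeast0LessThan)
  also have "\<dots> = (\<Sum>j<k. if i = j then f j * y $ j else 0)"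
    by (intro sum.cong) auto
  finally show "(mat_diag k f *\<^sub>v y) $ i = vec k (\<lambda>i. f i * y $ i) $ i" using i by simp
qed (simp add: mat_diag_def)

lemma smult_mat_mult_vec:
  assumes "M \<in> carrier_mat k l" "y \<in> carrier_vec l"
  shows "(a \<cdot>\<^sub>m M) *\<^sub>v y = a \<cdot>\<^sub>v (M *\<^sub>v y)"
  using assms by (intro eq_vecI) (auto simp: smult_scalar_prod_distrib[of _ l])

lemma transpose_smult: "(a \<cdot>\<^sub>m M)\<^sup>T = a \<cdot>\<^sub>m M\<^sup>T"
  by (intro eq_matI) auto

text \<open>With g = P^T b, the ansatz x = Q y turns M^T b into Q S g and M^T M x into Q S S y, so a
  diagonal system for y is enough. The resulting solution does not mention \<open>M\<close>; this is
  what lets two different matrices share it.\<close>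

lemma tikhonov_solutions_reduced_svd:
  assumes M: "M \<in> carrier_mat m n" and P: "P \<in> carrier_mat m s" and Q: "Q \<in> carrier_mat n s"
    and MQ: "M * Q = P * mat_diag s \<sigma>" and MP: "M\<^sup>T * P = Q * mat_diag s \<sigma>"
    and b: "b \<in> carrier_vec m" and Mb: "M\<^sup>T *\<^sub>v b = M\<^sup>T *\<^sub>v (P *\<^sub>v (P\<^sup>T *\<^sub>v b))"
    and l: "0 < l"
  shows "tikhonov_solutions n M b l
    = {Q *\<^sub>v vec s (\<lambda>i. \<sigma> i / ((\<sigma> i)\<^sup>2 + l\<^sup>2) * (P\<^sup>T *\<^sub>v b) $ i)}"
proof (rule tikhonov_solutions_normal_eq[OF M b l])
  let ?g = "P\<^sup>T *\<^sub>v b"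
  let ?y = "vec s (\<lambda>i. \<sigma> i / ((\<sigma> i)\<^sup>2 + l\<^sup>2) * ?g $ i)"
  let ?S = "mat_diag s \<sigma>"
  have g: "?g \<in> carrier_vec s" and y: "?y \<in> carrier_vec s" using P b by auto
  have S: "?S \<in> carrier_mat s s" by simp
  have Mt: "M\<^sup>T \<in> carrier_mat n m" using M by simp
  show x: "Q *\<^sub>v ?y \<in> carrier_vec n" using Q y by simp
  have Sv: "?S *\<^sub>v z \<in> carrier_vec s" if "z \<in> carrier_vec s" for z
    using mat_diag_dim that by (rule mult_mat_vec_carrier)
  have MPz: "M\<^sup>T *\<^sub>v (P *\<^sub>v z) = Q *\<^sub>v (?S *\<^sub>v z)" if z: "z \<in> carrier_vec s" for z
    using assoc_mult_mat_vec[OF Mt P z] assoc_mult_mat_vec[OF Q S z] MP by simp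
  have "M *\<^sub>v (Q *\<^sub>v ?y) = P *\<^sub>v (?S *\<^sub>v ?y)"
    using assoc_mult_mat_vec[OF M Q y] assoc_mult_mat_vec[OF P S y] MQ by simp
  then have "M\<^sup>T *\<^sub>v (b - M *\<^sub>v (Q *\<^sub>v ?y)) = M\<^sup>T *\<^sub>v b - M\<^sup>T *\<^sub>v (P *\<^sub>v (?S *\<^sub>v ?y))"
    using mult_minus_distrib_mat_vec[OF Mt b mult_mat_vec_carrier[OF P Sv[OF y]]] by simp
  also have "\<dots> = Q *\<^sub>v (?S *\<^sub>v ?g) - Q *\<^sub>v (?S *\<^sub>v (?S *\<^sub>v ?y))"
    unfolding Mb MPz[OF g] MPz[OF Sv[OF y]] ..
  also have "\<dots> = Q *\<^sub>v (?S *\<^sub>v ?g - ?S *\<^sub>v (?S *\<^sub>v ?y))"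
    using mult_minus_distrib_mat_vec[OF Q Sv[OF g] Sv[OF Sv[OF y]]] by simp
  \<comment> \<open>Componentwise this reads sigma g - sigma^2 y = l^2 y; the factor sigma /
    (sigma^2 + l^2) in \<open>?y\<close> is its solution.\<close>
  also have "?S *\<^sub>v ?g - ?S *\<^sub>v (?S *\<^sub>v ?y) = l\<^sup>2 \<cdot>\<^sub>v ?y"
  proof (rule eq_vecI)
    fix i assume "i < dim_vec (l\<^sup>2 \<cdot>\<^sub>v ?y)"
    then have i: "i < s" by simp
    have "(\<sigma> i)\<^sup>2 + l\<^sup>2 \<noteq> 0" using l by (simp add: add_nonneg_pos less_imp_neq[symmetric])
    then show "(?S *\<^sub>v ?g - ?S *\<^sub>v (?S *\<^sub>v ?y)) $ i = (l\<^sup>2 \<cdot>\<^sub>v ?y) $ i"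
      using i l by (simp add: mat_diag_mult_vec[OF g] mat_diag_mult_vec[OF y] mat_diag_mult_vec)
        (simp add: field_simps power2_eq_square)
  qed (simp add: mat_diag_def)
  also have "Q *\<^sub>v (l\<^sup>2 \<cdot>\<^sub>v ?y) = l\<^sup>2 \<cdot>\<^sub>v (Q *\<^sub>v ?y)"
    by (rule mult_mat_vec[OF Q y])
  finally show "M\<^sup>T *\<^sub>v (b - M *\<^sub>v (Q *\<^sub>v ?y)) = l\<^sup>2 \<cdot>\<^sub>v (Q *\<^sub>v ?y)" .
qed

section \<open>From the concatenated SVD to relations between blocks\<close>

lemma nth_concat_map_upt:
  assumes "i < s" "k < length (f i)"
  shows "(\<Sum>j<i. length (f j)) + k < length (concat (map f [0..<s]))"
    and "concat (map f [0..<s]) ! ((\<Sum>j<i. length (f j)) + k) = f i ! k"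
proof -
  have "[0..<s] = [0..<i] @ i # [Suc i..<s]"
    using upt_add_eq_append[of 0 i "s - i"] assms(1) by (simp add: upt_conv_Cons)
  then have eq: "concat (map f [0..<s])
      = concat (map f [0..<i]) @ f i @ concat (map f [Suc i..<s])" by simp
  have len: "length (concat (map f [0..<i])) = (\<Sum>j<i. length (f j))"
    by (simp add: length_concat comp_def interv_sum_list_conv_sum_set_nat atLeast0LessThan)
  show "(\<Sum>j<i. length (f j)) + k < length (concat (map f [0..<s]))"
    unfolding eq using len assms(2) by simp
  show "concat (map f [0..<s]) ! ((\<Sum>j<i. length (f j)) + k) = f i ! k"
    unfolding eq using assms(2) by (simp add: nth_append flip: len)
qed

text \<open>Flattens the block form of the singular value matrix: each value is repeated according
  to its multiplicity, so that the SVD can be read one column at a time.\<close>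

lemma diag_block_mat_scaled_ones:
  "diag_block_mat (map (\<lambda>i. \<sigma> i \<cdot>\<^sub>m 1\<^sub>m (c i)) [0..<s])
    = mat_diag (\<Sum>i<s. c i) (\<lambda>k. concat (map (\<lambda>i. replicate (c i) (\<sigma> i :: real)) [0..<s]) ! k)"
proof (induction s)
  case 0
  show ?case by (auto simp: mat_diag_def)
next
  case (Suc s)
  have len: "length (concat (map (\<lambda>i. replicate (c i) (\<sigma> i)) [0..<s])) = (\<Sum>i<s. c i)"
    by (simp add: length_concat comp_def interv_sum_list_conv_sum_set_nat atLeast0LessThan)
  show ?case
    \<comment> \<open>The induction extends the list of blocks on the right, so the last block is
      split off rather than the first.\<close>
    unfolding upt_Suc_append[OF le0] map_append list.map diag_block_mat_last Suc Let_def
    by (rule eq_matI) (auto simp: mat_diag_def nth_append len)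
qed

text \<open>Multiplying \<open>A\<close> by \<open>V\<close>, or its transpose by \<open>U\<close>,
  cancels one orthogonal factor. What remains is column \<open>q\<close> of the middle factor or of
  its transpose, and for q < n that is \<open>d q\<close> times a unit vector.\<close>

lemma svd_singular_vectors:
  fixes A :: "real mat"
  assumes U: "U \<in> carrier_mat m m" "U\<^sup>T * U = 1\<^sub>m m"
    and V: "V \<in> carrier_mat n n" "V\<^sup>T * V = 1\<^sub>m n"
    and nm: "n \<le> m" and A: "A = U * (mat_diag n d @\<^sub>r 0\<^sub>m (m - n) n) * V\<^sup>T"
    and q: "q < n"
  shows "A *\<^sub>v col V q = d q \<cdot>\<^sub>v col U q" and "A\<^sup>T *\<^sub>v col U q = d q \<cdot>\<^sub>v col V q"
proof -
  define D where "D = mat_diag n d @\<^sub>r 0\<^sub>m (m - n) n"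
  have D: "D \<in> carrier_mat m n"
    using carrier_append_rows[OF mat_diag_dim[of n d] zero_carrier_mat[of "m - n" n]] nm
    by (simp add: D_def)
  have entry: "D $$ (i, j) = (if i = j then d j else 0)" if "i < m" "j < n" for i j
    using that nm by (auto simp: D_def append_rows_def mat_diag_def)
  have Vt: "V\<^sup>T \<in> carrier_mat n n" and Ut: "U\<^sup>T \<in> carrier_mat m m" and Dt: "D\<^sup>T \<in> carrier_mat n m"
    using U V D by auto
  have UD: "U * D \<in> carrier_mat m n" and VD: "V * D\<^sup>T \<in> carrier_mat n m"
    using U(1) V(1) D by auto
  have A': "A = U * D * V\<^sup>T" using A by (simp add: D_def)
  have Ac: "A \<in> carrier_mat m n" using UD Vt by (simp add: A')
  have At: "A\<^sup>T \<in> carrier_mat n m" using Ac by simp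
  have qm: "q < m" using q nm by simp
  have "A * V = U * D"
    unfolding A' using assoc_mult_mat[OF UD Vt V(1)] V(2) right_mult_one_mat[OF UD] by simp
  then have "A *\<^sub>v col V q = U *\<^sub>v col D q"
    using col_mult2[OF Ac V(1) q] col_mult2[OF U(1) D q] by simp
  also have "col D q = d q \<cdot>\<^sub>v unit_vec m q"
    using D q qm by (intro eq_vecI) (auto simp: entry)
  also have "U *\<^sub>v (d q \<cdot>\<^sub>v unit_vec m q) = d q \<cdot>\<^sub>v (U *\<^sub>v unit_vec m q)"
    by (rule mult_mat_vec[OF U(1)]) simp
  also have "U *\<^sub>v unit_vec m q = col U q"
    using U(1) qm by (intro eq_vecI) auto
  finally show "A *\<^sub>v col V q = d q \<cdot>\<^sub>v col U q" .
  have "A\<^sup>T = V * D\<^sup>T * U\<^sup>T"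
    unfolding A' using transpose_mult[OF UD Vt] transpose_mult[OF U(1) D]
      assoc_mult_mat[OF V(1) Dt Ut] by simp
  then have "A\<^sup>T * U = V * D\<^sup>T"
    using assoc_mult_mat[OF VD Ut U(1)] U(2) right_mult_one_mat[OF VD] by simp
  then have "A\<^sup>T *\<^sub>v col U q = V *\<^sub>v col (D\<^sup>T) q"
    using col_mult2[OF At U(1) qm] col_mult2[OF V(1) Dt qm] by simp
  also have "col (D\<^sup>T) q = d q \<cdot>\<^sub>v unit_vec n q"
    using D q qm by (intro eq_vecI) (auto simp: entry)
  also have "V *\<^sub>v (d q \<cdot>\<^sub>v unit_vec n q) = d q \<cdot>\<^sub>v (V *\<^sub>v unit_vec n q)"
    by (rule mult_mat_vec[OF V(1)]) simp
  also have "V *\<^sub>v unit_vec n q = col V q"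
    using V(1) q by (intro eq_vecI) auto
  finally show "A\<^sup>T *\<^sub>v col U q = d q \<cdot>\<^sub>v col V q" .
qed

text \<open>The interface to the SVD: its concatenated factors are taken apart only here. The last
  fact is completeness of the right singular vectors in dual form: a vector orthogonal to all blocks
  \<open>Vh i\<close> vanishes.\<close>

lemma block_svdD:
  assumes nm: "n \<le> m" and svd: "block_svd m n A s \<sigma> c Uh Uhperp Vh"
  shows "\<And>i j. i < s \<Longrightarrow> j < s \<Longrightarrow> (Uh i)\<^sup>T * Uh j = (if i = j then 1\<^sub>m (c i) else 0\<^sub>m (c i) (c j))"
    and "\<And>i. i < s \<Longrightarrow> A * Vh i = \<sigma> i \<cdot>\<^sub>m Uh i"
    and "\<And>i. i < s \<Longrightarrow> A\<^sup>T * Uh i = \<sigma> i \<cdot>\<^sub>m Vh i"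
    and "\<And>x. x \<in> carrier_vec n \<Longrightarrow> (\<And>i. i < s \<Longrightarrow> (Vh i)\<^sup>T *\<^sub>v x = 0\<^sub>v (c i)) \<Longrightarrow> x = 0\<^sub>v n"
proof -
  define U where "U = hcat m (map Uh [0..<s] @ [Uhperp])"
  define V where "V = hcat n (map Vh [0..<s])"
  define d where "d k = concat (map (\<lambda>i. replicate (c i) (\<sigma> i)) [0..<s]) ! k" for k
  \<comment> \<open>column k of block i is column \<open>pos i k\<close> of the concatenated matrix\<close>
  define pos where "pos i k = (\<Sum>j<i. c j) + k" for i k
  have Ac: "A \<in> carrier_mat m n" and sum_c: "(\<Sum>i<s. c i) = n"
    and Uh: "\<And>i. i < s \<Longrightarrow> Uh i \<in> carrier_mat m (c i)"
    and Vh: "\<And>i. i < s \<Longrightarrow> Vh i \<in> carrier_mat n (c i)"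
    and U: "U \<in> carrier_mat m m" "U\<^sup>T * U = 1\<^sub>m m"
    and V: "V \<in> carrier_mat n n" "V\<^sup>T * V = 1\<^sub>m n" "V * V\<^sup>T = 1\<^sub>m n"
    and A0: "A = U * (diag_block_mat (map (\<lambda>i. \<sigma> i \<cdot>\<^sub>m 1\<^sub>m (c i)) [0..<s]) @\<^sub>r 0\<^sub>m (m - n) n) * V\<^sup>T"
    using svd unfolding block_svd_def real_orthogonal_mat_def U_def V_def by auto
  have A: "A = U * (mat_diag n d @\<^sub>r 0\<^sub>m (m - n) n) * V\<^sup>T"
    using A0 unfolding diag_block_mat_scaled_ones sum_c by (simp add: d_def[abs_def])
  have U_eq: "U = mat_of_cols m (concat (map (\<lambda>i. cols (Uh i)) [0..<s]) @ cols Uhperp)"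
    by (simp add: U_def hcat_def comp_def)
  have V_eq: "V = mat_of_cols n (concat (map (\<lambda>i. cols (Vh i)) [0..<s]))"
    by (simp add: V_def hcat_def comp_def)
  \<comment> \<open>Kept generic in the element type: it serves columns and singular values, and
    also auxiliary lists chosen only for their length or their entries.\<close>
  have pos_f: "pos i k < length (concat (map f [0..<s]))"
       "concat (map f [0..<s]) ! pos i k = f i ! k"
    if i: "i < s" and k: "k < c i" and f: "\<And>i. i < s \<Longrightarrow> length (f i) = c i"
    for i k and f :: "nat \<Rightarrow> 'b list"
  proof -
    have "pos i k = (\<Sum>j<i. length (f j)) + k"
      unfolding pos_def using i f by (auto intro!: sum.cong)
    then show "pos i k < length (concat (map f [0..<s]))"
       "concat (map f [0..<s]) ! pos i k = f i ! k"
      using nth_concat_map_upt[of i s k f] i k f by auto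
  qed
  have pos_less: "pos i k < n" if "i < s" "k < c i" for i k
    \<comment> \<open>A list with \<open>c i\<close> dummy entries per block has total length
      \<open>n\<close>, so a valid position in it is below \<open>n\<close>.\<close>
    using pos_f(1)[OF that, of "\<lambda>i. replicate (c i) ()"] sum_c
    by (simp add: length_concat comp_def interv_sum_list_conv_sum_set_nat atLeast0LessThan)
  \<comment> \<open>injectivity comes for free by looking up the list of all index pairs at \<open>pos i k\<close>\<close>
  have pos_inj: "i = j \<and> k = l"
    if i: "i < s" "k < c i" and j: "j < s" "l < c j" and eq: "pos i k = pos j l" for i j k l
  proof -
    let ?f = "\<lambda>i. map (Pair i) [0..<c i]"
    have len: "\<And>i. i < s \<Longrightarrow> length (?f i) = c i" by simp
    have "?f i ! k = ?f j ! l"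
      using pos_f(2)[OF i len] pos_f(2)[OF j len] unfolding eq by (rule trans[OF sym])
    then show ?thesis using i j by simp
  qed
  have d_pos: "d (pos i k) = \<sigma> i" if "i < s" "k < c i" for i k
    using pos_f(2)[OF that, of "\<lambda>i. replicate (c i) (\<sigma> i)"] that by (simp add: d_def)
  have col_U: "col U (pos i k) = col (Uh i) k" if i: "i < s" and k: "k < c i" for i k
  proof -
    have len: "\<And>i. i < s \<Longrightarrow> length (cols (Uh i)) = c i" using Uh by auto
    have "col (Uh i) k \<in> carrier_vec m" using Uh[OF i] by (intro col_carrier_vec) (use k in auto)
    then show ?thesis
      using pos_f[OF i k, of "\<lambda>i. cols (Uh i)"] len Uh[OF i] k
      unfolding U_eq by (subst col_mat_of_cols) (auto simp: nth_append)
  qed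
  have col_V: "col V (pos i k) = col (Vh i) k" if i: "i < s" and k: "k < c i" for i k
  proof -
    have len: "\<And>i. i < s \<Longrightarrow> length (cols (Vh i)) = c i" using Vh by auto
    have "col (Vh i) k \<in> carrier_vec n" using Vh[OF i] by (intro col_carrier_vec) (use k in auto)
    then show ?thesis
      using pos_f[OF i k, of "\<lambda>i. cols (Vh i)"] len Vh[OF i] k
      unfolding V_eq by (subst col_mat_of_cols) auto
  qed
  note sv = svd_singular_vectors[OF U V(1,2) nm A]
  show "(Uh i)\<^sup>T * Uh j = (if i = j then 1\<^sub>m (c i) else 0\<^sub>m (c i) (c j))" if i: "i < s" and j: "j < s" for i j
  proof (rule eq_matI)
    fix k l
    assume "k < dim_row (if i = j then 1\<^sub>m (c i) else 0\<^sub>m (c i) (c j) :: real mat)"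
      "l < dim_col (if i = j then 1\<^sub>m (c i) else 0\<^sub>m (c i) (c j) :: real mat)"
    then have k: "k < c i" and l: "l < c j" by (auto split: if_splits)
    have km: "pos i k < m" and lm: "pos j l < m" using pos_less i j k l nm by fastforce+
    have "((Uh i)\<^sup>T * Uh j) $$ (k, l) = col (Uh i) k \<bullet> col (Uh j) l"
      using Uh[OF i] Uh[OF j] k l by simp
    \<comment> \<open>Block orthogonality is orthonormality of \<open>U\<close> read at the
      positions of the two columns; injectivity of \<open>pos\<close> then identifies the
      diagonal.\<close>
    also have "\<dots> = (U\<^sup>T * U) $$ (pos i k, pos j l)"
      unfolding col_U[OF i k, symmetric] col_U[OF j l, symmetric] using U(1) km lm by simp
    also have "\<dots> = (if pos i k = pos j l then 1 else 0)"
      unfolding U(2) using km lm by simp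
    also have "\<dots> = (if i = j then 1\<^sub>m (c i) else 0\<^sub>m (c i) (c j)) $$ (k, l)"
      using pos_inj[OF i k j l] k l by auto
    finally show "((Uh i)\<^sup>T * Uh j) $$ (k, l) = (if i = j then 1\<^sub>m (c i) else 0\<^sub>m (c i) (c j)) $$ (k, l)" .
  qed (use Uh[OF i] Uh[OF j] in auto)
  show "A * Vh i = \<sigma> i \<cdot>\<^sub>m Uh i" if i: "i < s" for i
  proof (rule mat_col_eqI)
    fix k assume "k < dim_col (\<sigma> i \<cdot>\<^sub>m Uh i)"
    then have k: "k < c i" using Uh[OF i] by simp
    show "col (A * Vh i) k = col (\<sigma> i \<cdot>\<^sub>m Uh i) k"
      using sv(1)[OF pos_less[OF i k]] col_mult2[OF Ac Vh[OF i] k] Uh[OF i] k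
      by (simp add: col_U[OF i k] col_V[OF i k] d_pos[OF i k])
  qed (use Ac Uh[OF i] Vh[OF i] in auto)
  show "A\<^sup>T * Uh i = \<sigma> i \<cdot>\<^sub>m Vh i" if i: "i < s" for i
  proof (rule mat_col_eqI)
    fix k assume "k < dim_col (\<sigma> i \<cdot>\<^sub>m Vh i)"
    then have k: "k < c i" using Vh[OF i] by simp
    show "col (A\<^sup>T * Uh i) k = col (\<sigma> i \<cdot>\<^sub>m Vh i) k"
      using sv(2)[OF pos_less[OF i k]] col_mult2[OF _ Uh[OF i] k, of "A\<^sup>T" n] Ac Vh[OF i] k
      by (simp add: col_U[OF i k] col_V[OF i k] d_pos[OF i k])
  qed (use Ac Uh[OF i] Vh[OF i] in auto)
  show "x = 0\<^sub>v n"
    if x: "x \<in> carrier_vec n" and orth: "\<And>i. i < s \<Longrightarrow> (Vh i)\<^sup>T *\<^sub>v x = 0\<^sub>v (c i)" for x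
  proof -
    have "V\<^sup>T *\<^sub>v x = 0\<^sub>v n"
    proof (rule eq_vecI)
      fix q assume "q < dim_vec (0\<^sub>v n :: real vec)"
      then have q: "q < n" by simp
      let ?L = "concat (map (\<lambda>i. cols (Vh i)) [0..<s])"
      have "dim_col V = length ?L" by (simp add: V_eq mat_of_cols_def)
      then have qL: "q < length ?L" using q V(1) by simp
      \<comment> \<open>No inverse of \<open>pos\<close> is required: membership in the concatenated
        list already supplies a block and a column within it.\<close>
      then have "?L ! q \<in> set ?L" by (rule nth_mem)
      then obtain i where i: "i < s" and "?L ! q \<in> set (cols (Vh i))" by auto
      then obtain k where k: "k < c i" and eq: "?L ! q = col (Vh i) k"
        using Vh[OF i] by (auto simp: cols_def)
      have "col (Vh i) k \<in> carrier_vec n" using Vh[OF i] by (intro col_carrier_vec) (use k in auto)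
      then have "col V q = col (Vh i) k"
        unfolding V_eq using qL eq by (subst col_mat_of_cols) auto
      moreover have "col (Vh i) k \<bullet> x = ((Vh i)\<^sup>T *\<^sub>v x) $ k"
        using Vh[OF i] k by simp
      ultimately show "(V\<^sup>T *\<^sub>v x) $ q = 0\<^sub>v n $ q"
        using V(1) q k orth[OF i] by simp
    qed (use V(1) in auto)
    moreover have "x = V *\<^sub>v (V\<^sup>T *\<^sub>v x)"
      using assoc_mult_mat_vec[of V n n "V\<^sup>T" n x] V x by simp
    ultimately show ?thesis using V(1) by auto
  qed
qed

section \<open>Collapsing A' to its first s singular triples\<close>

text \<open>Each entry of the product is a sum over the columns weighted by the diagonal, and the
  weights vanish on the appended columns.\<close>

lemma mat_of_cols_append_diag:
  fixes f :: "nat \<Rightarrow> real"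
  assumes us: "length us = s" and vs: "length vs = s" and ws: "length ws = t" and zs: "length zs = t"
  shows "mat_of_cols m (us @ ws) * mat_diag (s + t) (\<lambda>i. if i < s then f i else 0)
      * (mat_of_cols n (vs @ zs))\<^sup>T
    = mat_of_cols m us * mat_diag s f * (mat_of_cols n vs)\<^sup>T"
proof (rule eq_matI)
  have c: "mat_of_cols m (us @ ws) \<in> carrier_mat m (s + t)" "mat_of_cols m us \<in> carrier_mat m s"
    "mat_of_cols n (vs @ zs) \<in> carrier_mat n (s + t)" "mat_of_cols n vs \<in> carrier_mat n s"
    using assms mat_of_cols_carrier(1)[of m "us @ ws"] mat_of_cols_carrier(1)[of m us]
      mat_of_cols_carrier(1)[of n "vs @ zs"] mat_of_cols_carrier(1)[of n vs] by auto
  fix i j assume "i < dim_row (mat_of_cols m us * mat_diag s f * (mat_of_cols n vs)\<^sup>T)"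
    "j < dim_col (mat_of_cols m us * mat_diag s f * (mat_of_cols n vs)\<^sup>T)"
  then have i: "i < m" and j: "j < n" by auto
  have "(mat_of_cols m (us @ ws) * mat_diag (s + t) (\<lambda>i. if i < s then f i else 0)
      * (mat_of_cols n (vs @ zs))\<^sup>T) $$ (i, j)
    = (\<Sum>k<s + t. (us @ ws) ! k $ i * (if k < s then f k else 0) * (vs @ zs) ! k $ j)"
    unfolding mat_diag_mult_right[OF c(1)] using c(3) i j assms
    by (simp add: scalar_prod_def atLeast0LessThan mat_of_cols_index)
  also have "\<dots> = (\<Sum>k<s. us ! k $ i * f k * vs ! k $ j)"
    by (rule sum.mono_neutral_cong_right) (auto simp: nth_append us vs)
  also have "\<dots> = (mat_of_cols m us * mat_diag s f * (mat_of_cols n vs)\<^sup>T) $$ (i, j)"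
    unfolding mat_diag_mult_right[OF c(2)] using c(4) i j assms
    by (simp add: scalar_prod_def atLeast0LessThan mat_of_cols_index)
  finally show "(mat_of_cols m (us @ ws) * mat_diag (s + t) (\<lambda>i. if i < s then f i else 0)
      * (mat_of_cols n (vs @ zs))\<^sup>T) $$ (i, j)
    = (mat_of_cols m us * mat_diag s f * (mat_of_cols n vs)\<^sup>T) $$ (i, j)" .
qed auto

lemma A_prime_reduced:
  assumes u: "\<And>i. i < s \<Longrightarrow> left_vec (Uh i) b \<in> carrier_vec m" and A: "A \<in> carrier_mat m n"
    and W: "\<And>i. i < s \<Longrightarrow> set (W i) \<subseteq> carrier_vec m"
    and len: "\<And>i. i < s \<Longrightarrow> length (W i) = c i - 1"
    and c: "\<And>i. i < s \<Longrightarrow> 1 \<le> c i" and n: "(\<Sum>i<s. c i) = n"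
  shows "A_prime m n A s \<sigma> Uh b W
    = mat_of_cols m (map (\<lambda>i. left_vec (Uh i) b) [0..<s]) * mat_diag s \<sigma>
      * (mat_of_cols n (map (\<lambda>i. right_vec A (\<sigma> i) (left_vec (Uh i) b)) [0..<s]))\<^sup>T"
proof -
  let ?us = "map (\<lambda>i. left_vec (Uh i) b) [0..<s]"
  let ?vs = "map (\<lambda>i. right_vec A (\<sigma> i) (left_vec (Uh i) b)) [0..<s]"
  let ?ws = "concat (map W [0..<s])"
  let ?zs = "concat (map (\<lambda>i. map (right_vec A (\<sigma> i)) (W i)) [0..<s])"
  define t where "t = (\<Sum>i<s. c i - 1)"
  have right: "right_vec A a x \<in> carrier_vec n" if "x \<in> carrier_vec m" for a x
    using A that by (simp add: right_vec_def)
  \<comment> \<open>The dimension check lets \<open>cols\<close> recover the lists from the two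
    halves of \<open>Umat\<close>, so that \<open>hcat\<close> becomes plain list append.\<close>
  have "set ?us \<subseteq> carrier_vec m" "set ?ws \<subseteq> carrier_vec m"
    using u W by fastforce+
  then have U: "Umat m s Uh b W = mat_of_cols m (?us @ ?ws)"
    by (simp add: Umat_def hcat_def)
  have "set ?vs \<subseteq> carrier_vec n" "set ?zs \<subseteq> carrier_vec n"
    using u W right by fastforce+
  then have V: "Vmat n A s \<sigma> Uh b W = mat_of_cols n (?vs @ ?zs)"
    by (simp add: Vmat_def hcat_def)
  have ws: "length ?ws = t" and zs: "length ?zs = t"
    using len by (simp_all add: t_def length_concat comp_def interv_sum_list_conv_sum_set_nat
        atLeast0LessThan)
  \<comment> \<open>Subtraction on naturals is truncated; nonempty blocks make c = 1 + (c - 1)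
    valid, so the n diagonal positions split into s leading and t additional ones.\<close>
  have "n = (\<Sum>i<s. 1 + (c i - 1))"
    unfolding n[symmetric] by (intro sum.cong refl) (metis c lessThan_iff le_add_diff_inverse)
  also have "\<dots> = s + t" by (simp only: sum.distrib t_def) simp
  finally have nt: "n = s + t" .
  have D: "mat_diag n f = mat_diag (s + t) f" for f :: "nat \<Rightarrow> real"
    using nt by simp
  show ?thesis
    unfolding A_prime_def U V D
    by (rule mat_of_cols_append_diag) (simp_all add: ws zs)
qed

section \<open>The directions u_i carry the whole block component of b\<close>

text \<open>With w_i = Uh_i^T b one has u_i = Uh_i w_i / |w_i| and u_i . b = |w_i|. Hence P P^T b is
  the sum of the Uh_i w_i, from which Uh_j^T extracts w_j by block orthogonality.\<close>

lemma left_vec_projection: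
  assumes Uh: "\<And>i. i < s \<Longrightarrow> Uh i \<in> carrier_mat m (c i)" and b: "b \<in> carrier_vec m"
    and orth: "\<And>i j. i < s \<Longrightarrow> j < s \<Longrightarrow>
      (Uh i)\<^sup>T * Uh j = (if i = j then 1\<^sub>m (c i) else 0\<^sub>m (c i) (c j))"
    and nz: "\<And>i. i < s \<Longrightarrow> (Uh i)\<^sup>T *\<^sub>v b \<noteq> 0\<^sub>v (c i)"
  defines "P \<equiv> mat_of_cols m (map (\<lambda>i. left_vec (Uh i) b) [0..<s])"
  shows "P\<^sup>T * P = 1\<^sub>m s"
    and "\<And>j. j < s \<Longrightarrow> (Uh j)\<^sup>T *\<^sub>v (P *\<^sub>v (P\<^sup>T *\<^sub>v b)) = (Uh j)\<^sup>T *\<^sub>v b"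
proof -
  define w where "w i = (Uh i)\<^sup>T *\<^sub>v b" for i
  define u where "u i = left_vec (Uh i) b" for i
  have w: "w i \<in> carrier_vec (c i)" if "i < s" for i
    using Uh[OF that] b by (auto simp: w_def)
  have Uw: "Uh i *\<^sub>v w i \<in> carrier_vec m" if "i < s" for i
    using Uh[OF that] w[OF that] by (rule mult_mat_vec_carrier)
  have norm: "0 < vec_norm2 (w i)" "w i \<bullet> w i = (vec_norm2 (w i))\<^sup>2" if "i < s" for i
    using vec_norm2_pos[OF w[OF that]] nz[OF that] vec_norm2_sq(1)[OF w[OF that]]
    by (simp_all add: w_def)
  have u_eq: "u i = (1 / vec_norm2 (w i)) \<cdot>\<^sub>v (Uh i *\<^sub>v w i)" for i
    by (simp add: u_def w_def left_vec_def)
  have u: "u i \<in> carrier_vec m" if "i < s" for i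
    using Uw[OF that] by (simp add: u_eq)
  have Pc: "P \<in> carrier_mat m s" using mat_of_cols_carrier(1)[of m "map u [0..<s]"]
    by (simp add: P_def u_def[abs_def])
  have colP: "col P i = u i" if "i < s" for i
    using u[OF that] that by (simp add: P_def flip: u_def)
  have block: "(Uh j)\<^sup>T *\<^sub>v u i = (if i = j then (1 / vec_norm2 (w j)) \<cdot>\<^sub>v w j else 0\<^sub>v (c j))"
    if i: "i < s" and j: "j < s" for i j
  proof -
    have Ujt: "(Uh j)\<^sup>T \<in> carrier_mat (c j) m" using Uh[OF j] by simp
    have "(Uh j)\<^sup>T *\<^sub>v u i = (1 / vec_norm2 (w i)) \<cdot>\<^sub>v (((Uh j)\<^sup>T * Uh i) *\<^sub>v w i)"
      unfolding u_eq mult_mat_vec[OF Ujt Uw[OF i]] assoc_mult_mat_vec[OF Ujt Uh[OF i] w[OF i]] ..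
    also have "\<dots> = (if i = j then (1 / vec_norm2 (w j)) \<cdot>\<^sub>v w j else 0\<^sub>v (c j))"
      unfolding orth[OF j i] using w[OF i] w[OF j] by (auto intro!: eq_vecI)
    finally show ?thesis .
  qed
  have uu: "u i \<bullet> u j = (if i = j then 1 else 0)" if i: "i < s" and j: "j < s" for i j
  proof -
    have "u i \<bullet> u j = (1 / vec_norm2 (w j)) * (u i \<bullet> (Uh j *\<^sub>v w j))"
      unfolding u_eq[of j] using u[OF i] Uw[OF j] by simp
    also have "u i \<bullet> (Uh j *\<^sub>v w j) = ((Uh j)\<^sup>T *\<^sub>v u i) \<bullet> w j"
      using transpose_vec_mult_scalar[OF Uh[OF j] w[OF j] u[OF i]] by simp
    also have "(1 / vec_norm2 (w j)) * \<dots> = (if i = j then 1 else 0)"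
      unfolding block[OF i j] using w[OF j] norm[OF j] by (simp add: power2_eq_square)
    finally show ?thesis .
  qed
  show "P\<^sup>T * P = 1\<^sub>m s"
    using Pc by (intro eq_matI) (auto simp: colP uu)
  have ub: "u i \<bullet> b = vec_norm2 (w i)" if i: "i < s" for i
  proof -
    have "u i \<bullet> b = (1 / vec_norm2 (w i)) * (b \<bullet> (Uh i *\<^sub>v w i))"
      unfolding u_eq using Uw[OF i] b by (simp add: comm_scalar_prod[OF Uw[OF i] b])
    also have "b \<bullet> (Uh i *\<^sub>v w i) = w i \<bullet> w i"
      using transpose_vec_mult_scalar[OF Uh[OF i] w[OF i] b] by (simp add: w_def)
    finally show ?thesis using norm[OF i] by (simp add: power2_eq_square)
  qed
  have Ptb: "P\<^sup>T *\<^sub>v b = vec s (\<lambda>i. vec_norm2 (w i))"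
    using Pc by (intro eq_vecI) (auto simp: colP ub)
  show "(Uh j)\<^sup>T *\<^sub>v (P *\<^sub>v (P\<^sup>T *\<^sub>v b)) = (Uh j)\<^sup>T *\<^sub>v b" if j: "j < s" for j
  proof -
    have Ujt: "(Uh j)\<^sup>T \<in> carrier_mat (c j) m" using Uh[OF j] by simp
    have UP: "(Uh j)\<^sup>T * P \<in> carrier_mat (c j) s" using Ujt Pc by (rule mult_carrier_mat)
    have entry: "((Uh j)\<^sup>T * P) $$ (k, i) = (if i = j then w j $ k / vec_norm2 (w j) else 0)"
      if k: "k < c j" and i: "i < s" for k i
    proof -
      have "((Uh j)\<^sup>T * P) $$ (k, i) = ((Uh j)\<^sup>T *\<^sub>v u i) $ k"
        using Uh[OF j] Pc k i by (simp add: colP)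
      then show ?thesis unfolding block[OF i j] using w[OF j] k by simp
    qed
    have "(Uh j)\<^sup>T *\<^sub>v (P *\<^sub>v (P\<^sup>T *\<^sub>v b)) = ((Uh j)\<^sup>T * P) *\<^sub>v vec s (\<lambda>i. vec_norm2 (w i))"
      unfolding Ptb using assoc_mult_mat_vec[OF Ujt Pc vec_carrier] by simp
    also have "\<dots> = w j"
    proof (rule eq_vecI)
      fix k assume "k < dim_vec (w j)"
      then have k: "k < c j" using w[OF j] by simp
      have "(E *\<^sub>v vec s f) $ k = (\<Sum>i<s. E $$ (k, i) * f i)"
        if "E \<in> carrier_mat (c j) s" for E :: "real mat" and f
        using that k by (simp add: scalar_prod_def atLeast0LessThan)
      from this[OF UP] have "(((Uh j)\<^sup>T * P) *\<^sub>v vec s (\<lambda>i. vec_norm2 (w i))) $ k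
        = (\<Sum>i<s. ((Uh j)\<^sup>T * P) $$ (k, i) * vec_norm2 (w i))" .
      \<comment> \<open>The norm dividing \<open>u j\<close> cancels against entry j of P^T b, which
        is that same norm.\<close>
      also have "\<dots> = (\<Sum>i<s. if i = j then w j $ k else 0)"
        using entry[OF k] norm(1)[OF j] by (intro sum.cong) auto
      also have "\<dots> = w j $ k" using j by simp
      finally show "(((Uh j)\<^sup>T * P) *\<^sub>v vec s (\<lambda>i. vec_norm2 (w i))) $ k = w j $ k" .
    qed (use UP w[OF j] Uh[OF j] in auto)
    finally show ?thesis by (simp add: w_def)
  qed
qed

section \<open>The three relations for A and for A'\<close>

theorem theorem2p2:
  fixes m n s :: nat and A Uhperp :: "real mat" and b :: "real vec"
    and \<sigma> :: "nat \<Rightarrow> real" and c :: "nat \<Rightarrow> nat"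
    and Uh Vh :: "nat \<Rightarrow> real mat" and W :: "nat \<Rightarrow> real vec list" and lam :: real
  assumes "n \<le> m"
    and "block_svd m n A s \<sigma> c Uh Uhperp Vh"
    and "b \<in> carrier_vec m"
    and "\<And>i. i < s \<Longrightarrow> (Uh i)\<^sup>T *\<^sub>v b \<noteq> 0\<^sub>v (c i)"
    and "\<And>i. i < s \<Longrightarrow> length (W i) = c i - 1"
    and "\<And>i. i < s \<Longrightarrow>
           orthonormal_basis_list m (left_vec (Uh i) b # W i) (vec_space.col_space m (Uh i))"
    and "0 < lam"
  shows "\<exists>xl. tikhonov_solutions n A b lam = {xl}
            \<and> tikhonov_solutions n (A_prime m n A s \<sigma> Uh b W) b lam = {xl}"
proof -
  note svd = block_svdD[OF assms(1,2)]
  have A: "A \<in> carrier_mat m n" and sum_c: "(\<Sum>i<s. c i) = n"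
    and \<sigma>: "\<And>i. i < s \<Longrightarrow> 0 < \<sigma> i" and c: "\<And>i. i < s \<Longrightarrow> 1 \<le> c i"
    and Uh: "\<And>i. i < s \<Longrightarrow> Uh i \<in> carrier_mat m (c i)"
    and Vh: "\<And>i. i < s \<Longrightarrow> Vh i \<in> carrier_mat n (c i)"
    using assms(2) unfolding block_svd_def by auto
  have At: "A\<^sup>T \<in> carrier_mat n m" using A by simp
  have b: "b \<in> carrier_vec m" by fact
  define u where "u i = left_vec (Uh i) b" for i
  define v where "v i = right_vec A (\<sigma> i) (u i)" for i
  define P where "P = mat_of_cols m (map u [0..<s])"
  define Q where "Q = mat_of_cols n (map v [0..<s])"
  define S where "S = mat_diag s \<sigma>"
  have set_uW: "set (u i # W i) \<subseteq> carrier_vec m" if "i < s" for i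
    using assms(6)[OF that] by (simp add: orthonormal_basis_list_def u_def)
  have u: "u i \<in> carrier_vec m" if "i < s" for i using set_uW[OF that] by simp
  have v_eq: "v i = (1 / \<sigma> i) \<cdot>\<^sub>v (A\<^sup>T *\<^sub>v u i)" for i
    by (simp add: v_def right_vec_def)
  have v: "v i \<in> carrier_vec n" if "i < s" for i
    using mult_mat_vec_carrier[OF At u[OF that]] by (simp add: v_eq)
  have P: "P \<in> carrier_mat m s" and Q: "Q \<in> carrier_mat n s" and S: "S \<in> carrier_mat s s"
    using mat_of_cols_carrier(1)[of m "map u [0..<s]"] mat_of_cols_carrier(1)[of n "map v [0..<s]"]
    by (simp_all add: P_def Q_def S_def)
  have colP: "col P i = u i" and colQ: "col Q i = v i" if "i < s" for i
    using u[OF that] v[OF that] that by (simp_all add: P_def Q_def)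
  have scale: "col (M * S) i = \<sigma> i \<cdot>\<^sub>v col M i" if "M \<in> carrier_mat k s" "i < s" for M i k
    unfolding S_def mat_diag_mult_right[OF that(1)] using that by (intro eq_vecI) auto
  have PP: "P\<^sup>T * P = 1\<^sub>m s"
    and proj: "\<And>j. j < s \<Longrightarrow> (Uh j)\<^sup>T *\<^sub>v (P *\<^sub>v (P\<^sup>T *\<^sub>v b)) = (Uh j)\<^sup>T *\<^sub>v b"
    using left_vec_projection[of s Uh m c b, OF Uh b svd(1) assms(4)]
    by (simp_all add: P_def u_def[abs_def])
  have Atu: "A\<^sup>T *\<^sub>v u i = \<sigma> i \<cdot>\<^sub>v v i" if "i < s" for i
    using \<sigma>[OF that] mult_mat_vec_carrier[OF At u[OF that]]
    by (simp add: v_eq smult_smult_assoc)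
  \<comment> \<open>The vectors \<open>u i\<close> and \<open>v i\<close> have the same coordinates
    Uh_i^T b / |Uh_i^T b| with respect to the columns of \<open>Uh i\<close> and
    \<open>Vh i\<close>, and \<open>A\<close> carries the second block to \<open>\<sigma> i\<close>
    times the first.\<close>
  have Av: "A *\<^sub>v v i = \<sigma> i \<cdot>\<^sub>v u i" if i: "i < s" for i
  proof -
    let ?w = "(Uh i)\<^sup>T *\<^sub>v b"
    let ?a = "1 / vec_norm2 ?w"
    have w: "?w \<in> carrier_vec (c i)" using Uh[OF i] b by auto
    have Uw: "Uh i *\<^sub>v ?w \<in> carrier_vec m" using Uh[OF i] w by (rule mult_mat_vec_carrier)
    have Vw: "Vh i *\<^sub>v ?w \<in> carrier_vec n" using Vh[OF i] w by (rule mult_mat_vec_carrier)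
    have "A\<^sup>T *\<^sub>v u i = ?a \<cdot>\<^sub>v ((A\<^sup>T * Uh i) *\<^sub>v ?w)"
      unfolding u_def left_vec_def mult_mat_vec[OF At Uw] assoc_mult_mat_vec[OF At Uh[OF i] w] ..
    also have "\<dots> = ?a \<cdot>\<^sub>v (\<sigma> i \<cdot>\<^sub>v (Vh i *\<^sub>v ?w))"
      unfolding svd(3)[OF i] smult_mat_mult_vec[OF Vh[OF i] w] ..
    finally have vV: "v i = ?a \<cdot>\<^sub>v (Vh i *\<^sub>v ?w)"
      unfolding v_eq using \<sigma>[OF i] by (intro eq_vecI) auto
    have "A *\<^sub>v v i = ?a \<cdot>\<^sub>v ((A * Vh i) *\<^sub>v ?w)"
      unfolding vV mult_mat_vec[OF A Vw] assoc_mult_mat_vec[OF A Vh[OF i] w] ..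
    also have "\<dots> = ?a \<cdot>\<^sub>v (\<sigma> i \<cdot>\<^sub>v (Uh i *\<^sub>v ?w))"
      unfolding svd(2)[OF i] smult_mat_mult_vec[OF Uh[OF i] w] ..
    also have "\<dots> = \<sigma> i \<cdot>\<^sub>v u i"
      unfolding u_def left_vec_def by (simp add: smult_smult_assoc mult.commute)
    finally show ?thesis .
  qed
  have AQ: "A * Q = P * S"
  proof (rule mat_col_eqI)
    fix i assume "i < dim_col (P * S)"
    then have i: "i < s" using S by simp
    show "col (A * Q) i = col (P * S) i"
      unfolding col_mult2[OF A Q i] scale[OF P i] colP[OF i] colQ[OF i] by (rule Av[OF i])
  qed (use A P Q S in auto)
  have AP: "A\<^sup>T * P = Q * S"
  proof (rule mat_col_eqI)
    fix i assume "i < dim_col (Q * S)"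
    then have i: "i < s" using S by simp
    show "col (A\<^sup>T * P) i = col (Q * S) i"
      unfolding col_mult2[OF At P i] scale[OF Q i] colP[OF i] colQ[OF i] by (rule Atu[OF i])
  qed (use A P Q S in auto)
  \<comment> \<open>Orthonormality passes from left to right vectors by evaluating (A^T u_i) . v_j =
    u_i . (A v_j) with the singular relations on both sides.\<close>
  have QQ: "Q\<^sup>T * Q = 1\<^sub>m s"
  proof (rule eq_matI)
    fix i j assume "i < dim_row (1\<^sub>m s :: real mat)" "j < dim_col (1\<^sub>m s :: real mat)"
    then have i: "i < s" and j: "j < s" by auto
    have uu: "u i \<bullet> u j = (if i = j then 1 else 0)"
      using arg_cong[OF PP, of "\<lambda>M. M $$ (i, j)"] P i j by (simp add: colP)
    have "\<sigma> i * (v i \<bullet> v j) = (A\<^sup>T *\<^sub>v u i) \<bullet> v j"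
      unfolding Atu[OF i] using v[OF i] v[OF j] by simp
    also have "\<dots> = u i \<bullet> (A *\<^sub>v v j)"
      by (rule transpose_vec_mult_scalar[OF A v[OF j] u[OF i]])
    also have "\<dots> = \<sigma> j * (u i \<bullet> u j)"
      unfolding Av[OF j] using u[OF i] u[OF j] by simp
    finally have "v i \<bullet> v j = (if i = j then 1 else 0)"
      unfolding uu using \<sigma>[OF i] by (auto split: if_splits)
    then show "(Q\<^sup>T * Q) $$ (i, j) = 1\<^sub>m s $$ (i, j)"
      using Q i j by (simp add: colQ)
  qed (use Q in auto)
  \<comment> \<open>the \<open>Vh i\<close> span the whole space, so it suffices to test both sides against them\<close>
  have Ab: "A\<^sup>T *\<^sub>v b = A\<^sup>T *\<^sub>v (P *\<^sub>v (P\<^sup>T *\<^sub>v b))"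
  proof -
    let ?p = "P *\<^sub>v (P\<^sup>T *\<^sub>v b)"
    have p: "?p \<in> carrier_vec m" using P b by auto
    have bp: "b - ?p \<in> carrier_vec m" using b p by simp
    have "(Vh i)\<^sup>T *\<^sub>v (A\<^sup>T *\<^sub>v (b - ?p)) = 0\<^sub>v (c i)" if i: "i < s" for i
    proof -
      have Vt: "(Vh i)\<^sup>T \<in> carrier_mat (c i) n" and Ut: "(Uh i)\<^sup>T \<in> carrier_mat (c i) m"
        using Vh[OF i] Uh[OF i] by auto
      have Ub: "(Uh i)\<^sup>T *\<^sub>v b \<in> carrier_vec (c i)" using Ut b by (rule mult_mat_vec_carrier)
      have zero: "(Uh i)\<^sup>T *\<^sub>v (b - ?p) = 0\<^sub>v (c i)"
        unfolding mult_minus_distrib_mat_vec[OF Ut b p] proj[OF i] by (rule minus_cancel_vec[OF Ub])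
      \<comment> \<open>Transposing A Vh_i = sigma_i Uh_i converts the test against
        \<open>Vh i\<close> into one against \<open>Uh i\<close>, where \<open>b\<close> and its
        projection agree.\<close>
      have "(Vh i)\<^sup>T *\<^sub>v (A\<^sup>T *\<^sub>v (b - ?p)) = (A * Vh i)\<^sup>T *\<^sub>v (b - ?p)"
        unfolding transpose_mult[OF A Vh[OF i]] assoc_mult_mat_vec[OF Vt At bp] ..
      also have "\<dots> = \<sigma> i \<cdot>\<^sub>v ((Uh i)\<^sup>T *\<^sub>v (b - ?p))"
        unfolding svd(2)[OF i] transpose_smult by (rule smult_mat_mult_vec[OF Ut bp])
      also have "\<dots> = 0\<^sub>v (c i)" unfolding zero by (intro eq_vecI) auto
      finally show ?thesis .
    qed
    then have "A\<^sup>T *\<^sub>v (b - ?p) = 0\<^sub>v n"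
      using svd(4)[OF mult_mat_vec_carrier[OF At bp]] by blast
    then have "A\<^sup>T *\<^sub>v b - A\<^sup>T *\<^sub>v ?p = 0\<^sub>v n"
      unfolding mult_minus_distrib_mat_vec[OF At b p] .
    moreover have "x = y" if "x - y = 0\<^sub>v n" "x \<in> carrier_vec n" "y \<in> carrier_vec n"
      for x y :: "real vec"
    proof (rule eq_vecI)
      fix i assume "i < dim_vec y"
      then show "x $ i = y $ i"
        using arg_cong[OF that(1), of "\<lambda>z. z $ i"] that(2,3) by simp
    qed (use that in auto)
    ultimately show ?thesis
      using mult_mat_vec_carrier[OF At b] mult_mat_vec_carrier[OF At p] by blast
  qed
  define A' where "A' = A_prime m n A s \<sigma> Uh b W"
  have A'_eq: "A' = P * S * Q\<^sup>T"
    unfolding A'_def P_def Q_def S_def v_def[abs_def] u_def[abs_def]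
    by (rule A_prime_reduced[of s Uh b m A n W c])
      (use u A set_uW assms(5) c sum_c in \<open>auto simp: u_def\<close>)
  have PS: "P * S \<in> carrier_mat m s" and QS: "Q * S \<in> carrier_mat n s"
    and Pt: "P\<^sup>T \<in> carrier_mat s m" and Qt: "Q\<^sup>T \<in> carrier_mat s n"
    using P Q S by auto
  have A': "A' \<in> carrier_mat m n" using PS Qt by (simp add: A'_eq)
  have St: "S\<^sup>T = S" by (auto simp: S_def mat_diag_def)
  have A't: "A'\<^sup>T = Q * S * P\<^sup>T"
    unfolding A'_eq transpose_mult[OF PS Qt] transpose_mult[OF P S] St
    using assoc_mult_mat[OF Q S Pt] by simp
  have A'Q: "A' * Q = P * S"
    unfolding A'_eq assoc_mult_mat[OF PS Qt Q] QQ by (rule right_mult_one_mat[OF PS])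
  have A'P: "A'\<^sup>T * P = Q * S"
    unfolding A't assoc_mult_mat[OF QS Pt P] PP by (rule right_mult_one_mat[OF QS])
  have Ptb: "P\<^sup>T *\<^sub>v b \<in> carrier_vec s" using Pt b by (rule mult_mat_vec_carrier)
  \<comment> \<open>Both sides of the third relation for \<open>A'\<close> equal Q S P^T b: the left
    by the shape of its transpose, the right because P^T P = I.\<close>
  have "A'\<^sup>T *\<^sub>v (P *\<^sub>v (P\<^sup>T *\<^sub>v b)) = (Q * S) *\<^sub>v (P\<^sup>T *\<^sub>v b)"
    using assoc_mult_mat_vec[of "A'\<^sup>T" n m P s, OF _ P Ptb] A' A'P by simp
  then have A'b: "A'\<^sup>T *\<^sub>v b = A'\<^sup>T *\<^sub>v (P *\<^sub>v (P\<^sup>T *\<^sub>v b))"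
    unfolding A't using assoc_mult_mat_vec[OF QS Pt b] by simp
  show ?thesis
    using tikhonov_solutions_reduced_svd[OF A P Q AQ[unfolded S_def] AP[unfolded S_def] b Ab assms(7)]
      tikhonov_solutions_reduced_svd[OF A' P Q A'Q[unfolded S_def] A'P[unfolded S_def] b A'b assms(7)]
    unfolding A'_def by blast
qed

end
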